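(* For all $n\ge2$, the $f$-polynomial of $CRY_n$ and the primitive $f$-polynomial of $CRY_{n-1}$ are related by $$x\,f^{(n)}(x)=(1+x)^{n}\,\widetilde f^{(n-1)}(x).$$
   Context: For $n\ge1$, $K_{n+1}$ is the directed graph on $v_1,\dots,v_{n+1}$ with one edge $(v_i,v_j)$ for each $1\le i<j\le n+1$. A unit flow on $K_{n+1}$ is a function $f:E(K_{n+1})\to\mathbb R_{\ge0}$ such that $\sum_{j>i}f(v_i,v_j)-\sum_{k<i}f(v_k,v_i)$ equals $1$ for $i=1$ and $0$ for $2\le i\le n$. $CRY_n=\mathrm{Flow}_n(1,0,\dots,0)\subset\mathbb R^{E(K_{n+1})}$ is the polytope of all unit flows. Its $f$-polynomial is the Laurent polynomial $f^{(n)}(x)=\sum_{d\ge-1}f_d\,x^d$, where $f_d$ is the number of $d$-dimensional faces (the empty face counts as a face of dimension $-1$, and the polytope itself counts as a face). A subgraph $H\subseteq K_{n+1}$ is valid if its edge set is the support $\{e:f(e)>0\}$ of some unit flow (its vertex set being the set of endpoints of these edges). $H$ is primitive if it is connected (as an undirected graph) and $V(H)=\{v_1,\dots,v_{n+1}\}$. The first Betti number is $\beta_1(H)=|E(H)|-|V(H)|+c(H)$, with $c(H)$ the number of connected components. The primitive $f$-polynomial of $CRY_n$ is $\widetilde f^{(n)}(x)=\sum_H x^{\beta_1(H)}$, the sum over all valid primitive subgraphs $H$ of $K_{n+1}$. *)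

theory Defs
  imports
    "HOL-Analysis.Analysis"
    "HOL-Analysis.Finite_Function_Topology"
    "HOL-Computational_Algebra.Formal_Laurent_Series"
begin

text \<open>
  The vertex \<open>v\<^sub>i\<close> is the natural number \<open>i\<close>. Since \<open>n\<close> is not fixed, the spaces of real
  functions on the edge sets are realised as subspaces of the real vector space
  \<open>(nat \<times> nat) \<Rightarrow>\<^sub>0 real\<close> of finitely supported functions: a function on \<open>K_edges n\<close> is extended
  by zero to all pairs.
\<close>

definition K_verts :: "nat \<Rightarrow> nat set" where
  "K_verts n = {1..n + 1}"

definition K_edges :: "nat \<Rightarrow> (nat \<times> nat) set" where
  "K_edges n = {(i, j). 1 \<le> i \<and> i < j \<and> j \<le> n + 1}"

definition unit_flow :: "nat \<Rightarrow> ((nat \<times> nat) \<Rightarrow>\<^sub>0 real) \<Rightarrow> bool" where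
  "unit_flow n f \<longleftrightarrow>
     Poly_Mapping.keys f \<subseteq> K_edges n \<and>
     (\<forall>e \<in> K_edges n. 0 \<le> Poly_Mapping.lookup f e) \<and>
     (\<forall>i \<in> {1..n}.
        (\<Sum>j \<in> {i<..n + 1}. Poly_Mapping.lookup f (i, j)) -
        (\<Sum>k \<in> {1..<i}. Poly_Mapping.lookup f (k, i)) = (if i = 1 then 1 else 0))"

definition CRY :: "nat \<Rightarrow> ((nat \<times> nat) \<Rightarrow>\<^sub>0 real) set" where
  "CRY n = {f. unit_flow n f}"

text \<open>
  The library constant \<open>aff_dim\<close> is restricted to Euclidean spaces, which excludes
  \<open>(nat \<times> nat) \<Rightarrow>\<^sub>0 real\<close>. For a nonempty set, the following is the dimension of the direction
  space of its affine hull. The library's \<open>dim\<close> is \<open>0\<close> on infinite-dimensional sets, so this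
  is meaningful only for sets contained in a finite-dimensional subspace, as polytopes are.
\<close>

definition affine_dim :: "'a::real_vector set \<Rightarrow> int" where
  "affine_dim S = (if S = {} then -1 else int (dim {x - y | x y. x \<in> S \<and> y \<in> S}))"

lemma affine_dim_eq_aff_dim: "affine_dim S = aff_dim S"
  for S :: "'a::euclidean_space set"
proof (cases "S = {}")
  case False
  then obtain a where a: "a \<in> S" by blast
  let ?T = "(\<lambda>x. x - a) ` S"
  let ?D = "{x - y | x y. x \<in> S \<and> y \<in> S}"
  have sub: "?D \<subseteq> span ?T"
  proof
    fix z assume "z \<in> ?D"
    then obtain x y where xy: "z = x - y" "x \<in> S" "y \<in> S" by blast
    have "(x - a) - (y - a) \<in> span ?T"
      using xy by (intro span_diff span_base) auto
    then show "z \<in> span ?T" using xy by simp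
  qed
  have "?T \<subseteq> ?D" using a by blast
  then have "dim ?D = dim ?T"
    by (intro order_antisym dim_mono[OF sub] dim_subset)
  moreover have "aff_dim S = int (dim ?T)"
    using aff_dim_eq_dim_subtract[OF hull_inc[OF a]] by simp
  ultimately show ?thesis using False by (simp add: affine_dim_def)
qed (simp add: affine_dim_def)

text \<open>
  Following the library's \<open>face_of\<close>, both the empty set (of dimension \<open>-1\<close>) and the polytope
  itself are faces. Laurent polynomials are elements of \<open>int fls\<close>, where \<open>fls_X_intpow d\<close> is
  the monomial \<open>x\<^sup>d\<close>; a face of \<open>P\<close> has dimension at most that of \<open>P\<close>.
\<close>

definition f_number :: "'a::real_vector set \<Rightarrow> int \<Rightarrow> nat" where
  "f_number P d = card {F. F face_of P \<and> affine_dim F = d}"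

definition f_polynomial :: "'a::real_vector set \<Rightarrow> int fls" where
  "f_polynomial P = (\<Sum>d \<in> {-1..affine_dim P}. of_nat (f_number P d) * fls_X_intpow d)"

text \<open>Subgraphs without isolated vertices are represented by their edge sets.\<close>

definition valid_subgraph :: "nat \<Rightarrow> (nat \<times> nat) set \<Rightarrow> bool" where
  "valid_subgraph n H \<longleftrightarrow> (\<exists>f. unit_flow n f \<and> H = {e \<in> K_edges n. Poly_Mapping.lookup f e > 0})"

definition verts :: "(nat \<times> nat) set \<Rightarrow> nat set" where
  "verts H = fst ` H \<union> snd ` H"

definition linked :: "(nat \<times> nat) set \<Rightarrow> (nat \<times> nat) set" where
  "linked H = (H \<union> H\<inverse>)\<^sup>* \<inter> (verts H \<times> verts H)"

definition components_of_graph :: "(nat \<times> nat) set \<Rightarrow> nat set set" where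
  "components_of_graph H = verts H // linked H"

definition connected_graph :: "(nat \<times> nat) set \<Rightarrow> bool" where
  "connected_graph H \<longleftrightarrow> verts H \<noteq> {} \<and> (\<forall>u \<in> verts H. \<forall>v \<in> verts H. (u, v) \<in> linked H)"

definition primitive_subgraph :: "nat \<Rightarrow> (nat \<times> nat) set \<Rightarrow> bool" where
  "primitive_subgraph n H \<longleftrightarrow> connected_graph H \<and> verts H = K_verts n"

definition betti1 :: "(nat \<times> nat) set \<Rightarrow> int" where
  "betti1 H = int (card H) - int (card (verts H)) + int (card (components_of_graph H))"

definition primitive_f_polynomial :: "nat \<Rightarrow> int fls" where
  "primitive_f_polynomial n =
     (\<Sum>H | valid_subgraph n H \<and> primitive_subgraph n H. fls_X_intpow (betti1 H))"

end

theory Submission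
  imports Defs
begin

text \<open>
  Sending a face to the union of the supports of its flows identifies the nonempty faces of the
  flow polytope with the nonempty edge sets \<open>H\<close> in which every internal vertex is a head of an edge iff it
  is a tail of one; the dimension of the face is the first Betti number of \<open>H\<close>. Such graphs are
  built by adding the vertices in order. Weighting a dead end by \<open>(1 + x)\<^sup>k - 1\<close> and every tail by
  \<open>(1 + x)\<^sup>k\<close>, the sum \<open>h\<^sub>m(k)\<close> over the partial graphs on \<open>m + 1\<close> vertices satisfies
  \<open>h\<^sub>m\<^sub>+\<^sub>1(k) = w h\<^sub>m(k) + ((1 + x)\<^sup>k - 1) (h\<^sub>m(k + 1) - h\<^sub>m(k))\<close>, where \<open>w\<close> is the weight of a
  vertex left out: \<open>w = x\<close> gives all valid graphs and \<open>w = 0\<close> the primitive ones. By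
  induction the sums for \<open>w = x\<close> are, up to a power of \<open>1 + x\<close> and an additive power of \<open>x\<close>,
  the differences \<open>h\<^sub>m(k + 1) - h\<^sub>m(k)\<close> of the sums for \<open>w = 0\<close>; at \<open>k = 0\<close> this is the identity,
  the additive power of \<open>x\<close> accounting for the empty face.
\<close>

section \<open>Weighted enumeration of support graphs\<close>

lemma finite_K_edges: "finite (K_edges m)"
proof -
  have "K_edges m \<subseteq> {1..m + 1} \<times> {1..m + 1}" by (auto simp: K_edges_def)
  then show ?thesis by (rule finite_subset) auto
qed

text \<open>Vertex 1 always counts as a head, because the unit of flow enters there.\<close>

definition heads :: "(nat \<times> nat) set \<Rightarrow> nat set" where
  "heads H = insert 1 (snd ` H)"

text \<open>Partial graphs, in which only a vertex already reached may have out-edges. A head that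
  is not a tail is a dead end, still to be continued.\<close>

definition rooted_graphs :: "nat \<Rightarrow> (nat \<times> nat) set set" where
  "rooted_graphs m = {H. H \<subseteq> K_edges m \<and> fst ` H \<subseteq> heads H}"

text \<open>Flow conservation in combinatorial form, with sink \<open>m + 1\<close>: no edge leaves
  the sink, so it is added to the tails by hand.\<close>

definition support_graphs :: "nat \<Rightarrow> (nat \<times> nat) set set" where
  "support_graphs m = {H. H \<subseteq> K_edges m \<and> insert (m + 1) (fst ` H) = heads H}"

text \<open>\<open>w\<close> marks a vertex left out, \<open>x\<close> an edge, \<open>a\<close> a
  dead end and \<open>b\<close> a tail.\<close>

definition rooted_weight :: "'a::comm_ring_1 \<Rightarrow> 'a \<Rightarrow> 'a \<Rightarrow> 'a \<Rightarrow> nat \<Rightarrow> (nat \<times> nat) set \<Rightarrow> 'a" where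
  "rooted_weight w x a b m H = w ^ card (K_verts m - heads H) * x ^ card H
     * a ^ card (heads H - fst ` H) * b ^ card (fst ` H)"

definition rooted_sum :: "'a::comm_ring_1 \<Rightarrow> 'a \<Rightarrow> 'a \<Rightarrow> 'a \<Rightarrow> nat \<Rightarrow> 'a" where
  "rooted_sum w x a b m = (\<Sum>H \<in> rooted_graphs m. rooted_weight w x a b m H)"

lemma finite_rooted_graphs: "finite (rooted_graphs m)"
  by (rule finite_subset[of _ "Pow (K_edges m)"]) (auto simp: rooted_graphs_def finite_K_edges)

lemma finite_support_graphs: "finite (support_graphs m)"
  by (rule finite_subset[of _ "Pow (K_edges m)"]) (auto simp: support_graphs_def finite_K_edges)

lemma K_edges_0: "K_edges 0 = {}"
  by (auto simp: K_edges_def)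

lemma K_edges_finite_subset: "H \<subseteq> K_edges m \<Longrightarrow> finite H"
  by (rule finite_subset[OF _ finite_K_edges])

lemma finite_heads: "H \<subseteq> K_edges m \<Longrightarrow> finite (heads H)"
  by (auto simp: heads_def K_edges_finite_subset)

lemma heads_subset: "H \<subseteq> K_edges m \<Longrightarrow> heads H \<subseteq> {1..m + 1}"
  by (auto simp: heads_def K_edges_def)

lemma rooted_graphsD:
  assumes "H \<in> rooted_graphs m"
  shows "H \<subseteq> K_edges m" "fst ` H \<subseteq> heads H" "finite H" "finite (heads H)"
    "heads H \<subseteq> {1..m + 1}"
  using assms by (auto simp: rooted_graphs_def finite_heads K_edges_finite_subset heads_subset
      dest: subsetD[OF heads_subset])

section \<open>Extension of rooted graphs by a last vertex\<close>

lemma bij_betw_rooted_graphs_Suc: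
  "bij_betw (\<lambda>(H, S). H \<union> S \<times> {m + 2}) (SIGMA H:rooted_graphs m. Pow (heads H)) (rooted_graphs (Suc m))"
proof (rule bij_betwI[where g = "\<lambda>G. ({e \<in> G. snd e \<noteq> m + 2}, {i. (i, m + 2) \<in> G})"])
  show "(\<lambda>(H, S). H \<union> S \<times> {m + 2}) \<in> (SIGMA H:rooted_graphs m. Pow (heads H)) \<rightarrow> rooted_graphs (Suc m)"
  proof (clarify)
    fix H S assume H: "H \<in> rooted_graphs m" and S: "S \<subseteq> heads H"
    then have "S \<subseteq> {1..m + 1}" using heads_subset[of H m] by (auto simp: rooted_graphs_def)
    moreover have "heads H \<subseteq> heads (H \<union> S \<times> {m + 2})" by (auto simp: heads_def)
    moreover have "fst ` (H \<union> S \<times> {m + 2}) \<subseteq> fst ` H \<union> S" by auto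
    ultimately have "fst ` (H \<union> S \<times> {m + 2}) \<subseteq> heads (H \<union> S \<times> {m + 2})"
      using rooted_graphsD(2)[OF H] S by blast
    moreover have "H \<union> S \<times> {m + 2} \<subseteq> K_edges (Suc m)"
      using rooted_graphsD(1)[OF H] \<open>S \<subseteq> {1..m + 1}\<close> by (auto simp: K_edges_def)
    ultimately show "H \<union> S \<times> {m + 2} \<in> rooted_graphs (Suc m)"
      by (simp add: rooted_graphs_def)
  qed
next
  show "(\<lambda>G. ({e \<in> G. snd e \<noteq> m + 2}, {i. (i, m + 2) \<in> G}))
      \<in> rooted_graphs (Suc m) \<rightarrow> (SIGMA H:rooted_graphs m. Pow (heads H))"
  proof
    fix G assume "G \<in> rooted_graphs (Suc m)"
    then have G: "G \<subseteq> K_edges (Suc m)" "fst ` G \<subseteq> heads G" by (auto simp: rooted_graphs_def)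
    let ?H = "{e \<in> G. snd e \<noteq> m + 2}"
    \<comment> \<open>Since \<open>i < m + 2\<close>, an edge that makes \<open>i\<close> a head
      does not end in \<open>m + 2\<close> and so survives in \<open>?H\<close>.\<close>
    have *: "i \<in> heads ?H" if "(i, j) \<in> G" for i j
    proof -
      have "i \<in> heads G" using G that by force
      moreover have "i < m + 2" using G that by (auto simp: K_edges_def)
      ultimately show ?thesis by (force simp: heads_def)
    qed
    have "?H \<subseteq> K_edges m"
    proof
      fix e assume "e \<in> ?H"
      then show "e \<in> K_edges m" using G(1) by (cases e) (auto simp: K_edges_def)
    qed
    with * show "(?H, {i. (i, m + 2) \<in> G}) \<in> (SIGMA H:rooted_graphs m. Pow (heads H))"
      by (fastforce simp: rooted_graphs_def)
  qed
next
  fix p assume "p \<in> (SIGMA H:rooted_graphs m. Pow (heads H))"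
  then show "({e \<in> (case p of (H, S) \<Rightarrow> H \<union> S \<times> {m + 2}). snd e \<noteq> m + 2},
      {i. (i, m + 2) \<in> (case p of (H, S) \<Rightarrow> H \<union> S \<times> {m + 2})}) = p"
    by (cases p) (auto simp: rooted_graphs_def K_edges_def)
next
  fix G :: "(nat \<times> nat) set"
  show "(case ({e \<in> G. snd e \<noteq> m + 2}, {i. (i, m + 2) \<in> G}) of (H, S) \<Rightarrow> H \<union> S \<times> {m + 2}) = G"
    by auto
qed

lemma sum_rooted_graphs_Suc:
  "(\<Sum>G \<in> rooted_graphs (Suc m). g G)
     = (\<Sum>H \<in> rooted_graphs m. \<Sum>S \<in> Pow (heads H). g (H \<union> S \<times> {m + 2}))"
proof -
  have "(\<Sum>G \<in> rooted_graphs (Suc m). g G)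
      = (\<Sum>(H, S) \<in> (SIGMA H:rooted_graphs m. Pow (heads H)). g (H \<union> S \<times> {m + 2}))"
    by (subst sum.reindex_bij_betw[OF bij_betw_rooted_graphs_Suc, symmetric])
      (simp add: case_prod_unfold)
  also have "\<dots> = (\<Sum>H \<in> rooted_graphs m. \<Sum>S \<in> Pow (heads H). g (H \<union> S \<times> {m + 2}))"
    by (subst sum.Sigma) (auto simp: finite_rooted_graphs rooted_graphsD)
  finally show ?thesis .
qed

text \<open>Each element of \<open>A\<close> decides independently whether to join \<open>S\<close>.
  It contributes \<open>x * b\<close> if it does, and otherwise \<open>b\<close> or \<open>a\<close>
  according to membership in \<open>F\<close>; the sum is the expanded product of these
  binomials.\<close>

lemma sum_subsets_weight:
  fixes x a b :: "'a::comm_ring_1"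
  assumes "finite A" and "F \<subseteq> A"
  shows "(\<Sum>S \<in> Pow A. x ^ card S * a ^ card (A - (F \<union> S)) * b ^ card (F \<union> S))
    = (a + x * b) ^ card (A - F) * (b + x * b) ^ card F"
proof -
  let ?c = "\<lambda>i. if i \<in> F then b else a"
  have split: "prod f A = prod f (A - F) * prod f F" for f :: "_ \<Rightarrow> 'a"
    using assms by (simp add: prod.subset_diff)
  have "(a + x * b) ^ card (A - F) * (b + x * b) ^ card F = (\<Prod>i\<in>A. x * b + ?c i)"
    by (subst split) (simp add: add.commute)
  also have "\<dots> = (\<Sum>S \<in> Pow A. (\<Prod>i\<in>S. x * b) * (\<Prod>i\<in>A - S. ?c i))"
    by (rule prod_add) fact
  also have "\<dots> = (\<Sum>S \<in> Pow A. x ^ card S * a ^ card (A - (F \<union> S)) * b ^ card (F \<union> S))"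
  proof (rule sum.cong[OF refl])
    fix S assume "S \<in> Pow A"
    then have S: "S \<subseteq> A" "finite S" "finite F" using assms by (auto intro: finite_subset)
    have "A - S = (A - (F \<union> S)) \<union> (F - S)" "(A - (F \<union> S)) \<inter> (F - S) = {}"
      using assms by auto
    then have "(\<Prod>i\<in>A - S. ?c i) = (\<Prod>i\<in>A - (F \<union> S). ?c i) * (\<Prod>i\<in>F - S. ?c i)"
      using assms S by (simp add: prod.union_disjoint)
    also have "\<dots> = a ^ card (A - (F \<union> S)) * b ^ card (F - S)" by simp
    finally have 1: "(\<Prod>i\<in>A - S. ?c i) = a ^ card (A - (F \<union> S)) * b ^ card (F - S)" .
    have "card (F \<union> S) = card S + card (F - S)"
      using S by (metis Un_Diff_cancel Un_commute card_Un_disjoint Diff_disjoint finite_Diff)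
    then show "(\<Prod>i\<in>S. x * b) * (\<Prod>i\<in>A - S. ?c i)
        = x ^ card S * a ^ card (A - (F \<union> S)) * b ^ card (F \<union> S)"
      by (simp add: 1 power_add power_mult_distrib ac_simps)
  qed
  finally show ?thesis by simp
qed

lemma card_Un_Times:
  assumes "H \<subseteq> K_edges m" and "S \<subseteq> heads H"
  shows "card (H \<union> S \<times> {m + 2}) = card H + card S"
proof -
  have "finite S" using assms finite_heads finite_subset by blast
  moreover have "H \<inter> S \<times> {m + 2} = {}" using assms by (auto simp: K_edges_def)
  ultimately show ?thesis
    using assms by (simp add: card_Un_disjoint K_edges_finite_subset card_cartesian_product)
qed

lemma heads_Un_Times:
  "S \<noteq> {} \<Longrightarrow> heads (H \<union> S \<times> {m}) = insert m (heads H)"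
  by (auto simp: heads_def image_Un)

lemma fst_image_Un_Times: "fst ` (H \<union> S \<times> {m}) = fst ` H \<union> S"
  by (auto simp: image_Un)

lemma rooted_weight_extend_empty:
  assumes "H \<in> rooted_graphs m"
  shows "rooted_weight w x a b (Suc m) H = w * rooted_weight w x a b m H"
proof -
  have "K_verts (Suc m) - heads H = insert (m + 2) (K_verts m - heads H)"
    using rooted_graphsD(5)[OF assms] by (auto simp: K_verts_def)
  moreover have "finite (K_verts m - heads H)" "m + 2 \<notin> K_verts m - heads H"
    by (auto simp: K_verts_def)
  ultimately show ?thesis by (simp add: rooted_weight_def)
qed

text \<open>The new vertex is reached but has no out-edge, hence the factor \<open>a\<close> and the
  unchanged exponent of \<open>w\<close>.\<close>

lemma rooted_weight_extend:
  assumes H: "H \<in> rooted_graphs m" and S: "S \<subseteq> heads H" "S \<noteq> {}"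
  shows "rooted_weight w x a b (Suc m) (H \<union> S \<times> {m + 2})
    = a * (w ^ card (K_verts m - heads H) * x ^ card H
        * (x ^ card S * a ^ card (heads H - (fst ` H \<union> S)) * b ^ card (fst ` H \<union> S)))"
proof -
  note D = rooted_graphsD[OF H]
  have 1: "K_verts (Suc m) - insert (m + 2) (heads H) = K_verts m - heads H"
    by (auto simp: K_verts_def)
  have "m + 2 \<notin> fst ` H \<union> S" using D(5) subsetD[OF D(2)] S(1) by fastforce
  then have "insert (m + 2) (heads H) - (fst ` H \<union> S) = insert (m + 2) (heads H - (fst ` H \<union> S))"
    by auto
  then have 2: "card (insert (m + 2) (heads H) - (fst ` H \<union> S)) = Suc (card (heads H - (fst ` H \<union> S)))"
    using D by (auto intro!: card_insert_disjoint)
  show ?thesis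
    unfolding rooted_weight_def heads_Un_Times[OF S(2)] fst_image_Un_Times 1 2
      card_Un_Times[OF D(1) S(1)]
    by (simp add: power_add ac_simps)
qed

text \<open>The choice \<open>S = {}\<close> leaves the new vertex out and gives \<open>w\<close>. A
  nonempty \<open>S\<close> makes it a dead end and gives \<open>a\<close>; summing over all
  \<open>S\<close> by \<open>sum_subsets_weight\<close> shifts \<open>a\<close> and
  \<open>b\<close>, and the subtracted term removes \<open>S = {}\<close> again.\<close>

lemma rooted_sum_Suc:
  "rooted_sum w x a b (Suc m)
    = w * rooted_sum w x a b m
      + a * (rooted_sum w x (a + x * b) (b + x * b) m - rooted_sum w x a b m)"
proof -
  have "(\<Sum>S \<in> Pow (heads H). rooted_weight w x a b (Suc m) (H \<union> S \<times> {m + 2}))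
      = w * rooted_weight w x a b m H
        + a * (rooted_weight w x (a + x * b) (b + x * b) m H - rooted_weight w x a b m H)"
    if H: "H \<in> rooted_graphs m" for H
  proof -
    note D = rooted_graphsD[OF H]
    let ?c = "w ^ card (K_verts m - heads H) * x ^ card H"
    let ?g = "\<lambda>S. x ^ card S * a ^ card (heads H - (fst ` H \<union> S)) * b ^ card (fst ` H \<union> S)"
    have fin: "finite (Pow (heads H))" using D by simp
    have "(\<Sum>S \<in> Pow (heads H) - {{}}. rooted_weight w x a b (Suc m) (H \<union> S \<times> {m + 2}))
        = (\<Sum>S \<in> Pow (heads H) - {{}}. a * ?c * ?g S)"
      by (intro sum.cong) (auto simp: rooted_weight_extend[OF H, simplified] ac_simps)
    also have "\<dots> = a * ?c * ((\<Sum>S \<in> Pow (heads H). ?g S) - ?g {})"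
      using fin by (simp add: sum_distrib_left[symmetric] sum_diff1)
    also have "\<dots> = a * (rooted_weight w x (a + x * b) (b + x * b) m H - rooted_weight w x a b m H)"
      unfolding sum_subsets_weight[OF D(4) D(2)] by (simp add: rooted_weight_def algebra_simps)
    finally show ?thesis
      using sum.remove[OF fin, of "{}" "\<lambda>S. rooted_weight w x a b (Suc m) (H \<union> S \<times> {m + 2})"]
      by (simp add: rooted_weight_extend_empty[OF H])
  qed
  then show ?thesis
    unfolding rooted_sum_def sum_rooted_graphs_Suc
    by (simp add: sum.distrib sum_distrib_left sum_subtractf right_diff_distrib)
qed

lemma rooted_sum_0: "rooted_sum w x a b 0 = a"
proof -
  have "rooted_graphs 0 = {{}}" by (auto simp: rooted_graphs_def K_edges_0)
  then show ?thesis by (simp add: rooted_sum_def rooted_weight_def heads_def K_verts_def)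
qed

text \<open>The largest head has no out-edge, as this would lead to a larger head. So every rooted
  graph has a dead end.\<close>

lemma heads_not_subset_tails:
  assumes "H \<in> rooted_graphs m"
  shows "\<not> heads H \<subseteq> fst ` H"
proof
  note D = rooted_graphsD[OF assms]
  assume "heads H \<subseteq> fst ` H"
  moreover have "Max (heads H) \<in> heads H" using D by (intro Max_in) (auto simp: heads_def)
  ultimately obtain j where j: "(Max (heads H), j) \<in> H" by force
  then have "j \<in> heads H" by (force simp: heads_def)
  then have "j \<le> Max (heads H)" using D by simp
  with j D show False by (auto simp: K_edges_def)
qed

text \<open>The new vertex is the sink, so every dead end of \<open>H\<close> has to be joined to
  it. The condition is phrased as a vanishing cardinality so that a power of \<open>0\<close> can
  serve as its indicator.\<close>

lemma support_graph_iff: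
  assumes "H \<in> rooted_graphs m" and "S \<subseteq> heads H"
  shows "H \<union> S \<times> {m + 2} \<in> support_graphs (Suc m) \<longleftrightarrow> card (heads H - (fst ` H \<union> S)) = 0"
proof -
  note D = rooted_graphsD[OF assms(1)]
  have sub: "H \<union> S \<times> {m + 2} \<subseteq> K_edges (Suc m)"
    using bij_betwE[OF bij_betw_rooted_graphs_Suc, of m] assms by (auto simp: rooted_graphs_def)
  show ?thesis
  proof (cases "S = {}")
    \<comment> \<open>Both sides are false: the sink is not reached, and \<open>H\<close> has a dead
      end.\<close>
    case True
    have "m + 2 \<notin> heads H" using D by auto
    then have "H \<notin> support_graphs (Suc m)" by (auto simp: support_graphs_def)
    moreover have "card (heads H - fst ` H) \<noteq> 0" using heads_not_subset_tails[OF assms(1)] D by auto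
    ultimately show ?thesis using True by simp
  next
    case False
    have "m + 2 \<notin> heads H" "m + 2 \<notin> fst ` H \<union> S" using D(5) subsetD[OF D(2)] assms(2) by fastforce+
    then have "insert (m + 2) (fst ` H \<union> S) = insert (m + 2) (heads H) \<longleftrightarrow> heads H \<subseteq> fst ` H \<union> S"
      using D(2) assms(2) by (auto simp: insert_eq_iff)
    then show ?thesis
      using D sub unfolding support_graphs_def
      by (simp add: heads_Un_Times[OF False, simplified] fst_image_Un_Times[simplified])
  qed
qed

text \<open>In the last step a dead end must be joined to the sink, which weighs \<open>x\<close>,
  while a tail may or may not be joined, which weighs \<open>1 + x\<close>.\<close>

lemma sum_support_graphs:
  fixes w x :: "'a::comm_ring_1"
  shows "(\<Sum>H \<in> support_graphs (Suc m). w ^ card (K_verts (Suc m) - heads H) * x ^ card H)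
    = rooted_sum w x x (1 + x) m"
proof -
  let ?g = "\<lambda>H. w ^ card (K_verts (Suc m) - heads H) * x ^ card H"
  have sub: "support_graphs (Suc m) \<subseteq> rooted_graphs (Suc m)"
    by (auto simp: support_graphs_def rooted_graphs_def)
  have inner: "(\<Sum>S \<in> Pow (heads H). if H \<union> S \<times> {m + 2} \<in> support_graphs (Suc m)
      then ?g (H \<union> S \<times> {m + 2}) else 0) = rooted_weight w x x (1 + x) m H"
    if H: "H \<in> rooted_graphs m" for H
  proof -
    note D = rooted_graphsD[OF H]
    let ?c = "w ^ card (K_verts m - heads H) * x ^ card H"
    \<comment> \<open>As \<open>0 ^ 0 = 1\<close>, weight \<open>0\<close> for dead ends and
      \<open>1\<close> for tails selects exactly the sets \<open>S\<close> that complete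
      \<open>H\<close> to a support graph.\<close>
    have "(if H \<union> S \<times> {m + 2} \<in> support_graphs (Suc m) then ?g (H \<union> S \<times> {m + 2}) else 0)
        = ?c * (x ^ card S * 0 ^ card (heads H - (fst ` H \<union> S)) * 1 ^ card (fst ` H \<union> S))"
      if S: "S \<in> Pow (heads H)" for S
    proof (cases "S = {}")
      case True
      then show ?thesis using heads_not_subset_tails[OF H] D support_graph_iff[OF H, of "{}"]
        by (simp add: power_0_left)
    next
      case False
      have 1: "K_verts (Suc m) - heads (H \<union> S \<times> {m + 2}) = K_verts m - heads H"
        unfolding heads_Un_Times[OF False] by (auto simp: K_verts_def)
      show ?thesis
        unfolding 1 using S by (simp only: support_graph_iff[OF H] card_Un_Times[OF D(1)] Pow_iff)
          (simp add: power_add power_0_left)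
    qed
    then have "(\<Sum>S \<in> Pow (heads H). if H \<union> S \<times> {m + 2} \<in> support_graphs (Suc m)
        then ?g (H \<union> S \<times> {m + 2}) else 0)
      = (\<Sum>S \<in> Pow (heads H). ?c * (x ^ card S * 0 ^ card (heads H - (fst ` H \<union> S)) * 1 ^ card (fst ` H \<union> S)))"
      by (intro sum.cong) auto
    also have "\<dots> = ?c * ((0 + x * 1) ^ card (heads H - fst ` H) * (1 + x * 1) ^ card (fst ` H))"
      unfolding sum_distrib_left[symmetric] sum_subsets_weight[OF D(4) D(2)] ..
    finally show ?thesis by (simp add: rooted_weight_def ac_simps)
  qed
  have "(\<Sum>H \<in> support_graphs (Suc m). ?g H)
      = (\<Sum>H \<in> rooted_graphs (Suc m). if H \<in> support_graphs (Suc m) then ?g H else 0)"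
    using sub by (simp add: sum.If_cases finite_rooted_graphs Int_absorb1 Int_commute)
  also have "\<dots> = rooted_sum w x x (1 + x) m"
    unfolding sum_rooted_graphs_Suc rooted_sum_def by (intro sum.cong inner refl)
  finally show ?thesis .
qed

section \<open>A one-parameter family of weights stable under the recursion\<close>

definition spec_sum :: "'a::comm_ring_1 \<Rightarrow> 'a \<Rightarrow> nat \<Rightarrow> nat \<Rightarrow> 'a" where
  "spec_sum w x m k = rooted_sum w x ((1 + x) ^ k - 1) ((1 + x) ^ k) m"

lemma spec_sum_0: "spec_sum w x 0 k = (1 + x) ^ k - 1"
  by (simp add: spec_sum_def rooted_sum_0)

text \<open>The shift of \<open>a\<close> and \<open>b\<close> in \<open>rooted_sum_Suc\<close>
  raises \<open>k\<close> by one on this family. Its member \<open>k = 1\<close> is the pair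
  \<open>x\<close>, \<open>1 + x\<close> of \<open>sum_support_graphs\<close>.\<close>

lemma spec_sum_Suc:
  "spec_sum w x (Suc m) k
    = w * spec_sum w x m k + ((1 + x) ^ k - 1) * (spec_sum w x m (Suc k) - spec_sum w x m k)"
proof -
  have "(1 + x) ^ k - 1 + x * (1 + x) ^ k = (1 + x) ^ Suc k - 1"
    "(1 + x) ^ k + x * (1 + x) ^ k = (1 + x) ^ Suc k"
    by (simp_all add: algebra_simps)
  then show ?thesis by (simp only: spec_sum_def rooted_sum_Suc)
qed

text \<open>Every rooted graph has a dead end, and at \<open>k = 0\<close> a dead end weighs
  \<open>0\<close>.\<close>

lemma spec_sum_at_0: "spec_sum 0 x m 0 = 0"
  by (induction m) (simp_all add: spec_sum_0 spec_sum_Suc)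

text \<open>The induction has to cover all \<open>k\<close> at once, because the recursion raises
  \<open>k\<close>.\<close>

lemma spec_sum_relation:
  fixes x :: "'a::comm_ring_1"
  shows "spec_sum x x (Suc m) (Suc k) + x ^ Suc m
    = (1 + x) ^ (k + m + 2) * (spec_sum 0 x m (Suc k) - spec_sum 0 x m k)"
proof (induction m arbitrary: k)
  case 0
  show ?case by (simp add: spec_sum_0 spec_sum_Suc power_add power2_eq_square algebra_simps)
next
  case (Suc m)
  define q where "q k = (1 + x) ^ k - 1" for k
  define d where "d k = spec_sum 0 x m (Suc k) - spec_sum 0 x m k" for k
  \<comment> \<open>Adding the power of \<open>x\<close> preserves the recursion for
    \<open>w = x\<close>: it cancels in the difference and is multiplied by \<open>x\<close> in the
    other term.\<close>
  define h where "h k = spec_sum x x (Suc m) k + x ^ Suc m" for k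
  have IH: "h (Suc k) = (1 + x) ^ (k + m + 2) * d k" for k
    unfolding h_def d_def by (rule Suc.IH)
  \<comment> \<open>This supplies the factor \<open>1 + x\<close> by which the powers in
    \<open>IH\<close> at \<open>k\<close> and at \<open>Suc k\<close> differ.\<close>
  have q: "q (Suc k) - x = (1 + x) * q k" by (simp add: q_def algebra_simps)
  have "spec_sum x x (Suc (Suc m)) (Suc k) + x ^ Suc (Suc m)
      = x * h (Suc k) + q (Suc k) * (h (Suc (Suc k)) - h (Suc k))"
    unfolding spec_sum_Suc[of x x "Suc m"] by (simp add: h_def q_def algebra_simps)
  also have "\<dots> = q (Suc k) * h (Suc (Suc k)) - (q (Suc k) - x) * h (Suc k)"
    by (simp add: algebra_simps)
  also have "\<dots> = (1 + x) ^ (k + Suc m + 2) * (q (Suc k) * d (Suc k) - q k * d k)"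
    unfolding q IH by (simp add: algebra_simps)
  also have "q (Suc k) * d (Suc k) - q k * d k = spec_sum 0 x (Suc m) (Suc k) - spec_sum 0 x (Suc m) k"
    by (simp add: spec_sum_Suc d_def q_def)
  finally show ?case .
qed

text \<open>This is \<open>spec_sum_relation\<close> at \<open>k = 0\<close>, where the subtracted
  sum vanishes. With a missing vertex weighted by \<open>x\<close>, the exponent on the left is the
  first Betti number plus \<open>m + 2\<close>; on the right, \<open>w = 0\<close> keeps only the
  graphs that reach every vertex.\<close>

lemma support_graphs_relation:
  fixes x :: "'a::comm_ring_1"
  shows "(\<Sum>H \<in> support_graphs (m + 2). x ^ (card (K_verts (m + 2) - heads H) + card H)) + x ^ (m + 1)
    = (1 + x) ^ (m + 2) * (\<Sum>H | H \<in> support_graphs (m + 1) \<and> heads H = K_verts (m + 1). x ^ card H)"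
proof -
  have "spec_sum x x (Suc m) (Suc 0) + x ^ Suc m = (1 + x) ^ (m + 2) * spec_sum 0 x m (Suc 0)"
    using spec_sum_relation[of x m 0] by (simp add: spec_sum_at_0)
  moreover have "spec_sum w x m (Suc 0)
      = (\<Sum>H \<in> support_graphs (Suc m). w ^ card (K_verts (Suc m) - heads H) * x ^ card H)" for w m
    unfolding sum_support_graphs by (simp add: spec_sum_def)
  moreover have "(\<Sum>H \<in> support_graphs (Suc m). 0 ^ card (K_verts (Suc m) - heads H) * x ^ card H)
      = (\<Sum>H | H \<in> support_graphs (m + 1) \<and> heads H = K_verts (m + 1). x ^ card H)"
  proof -
    have *: "0 ^ card (K_verts (Suc m) - heads H) * x ^ card H
        = (if heads H = K_verts (m + 1) then x ^ card H else 0)" if "H \<in> support_graphs (Suc m)" for H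
    proof -
      have "heads H \<subseteq> K_verts (m + 1)"
        using that heads_subset[of H "Suc m"] by (auto simp: support_graphs_def K_verts_def)
      then have "card (K_verts (Suc m) - heads H) = 0 \<longleftrightarrow> heads H = K_verts (m + 1)"
        by (auto simp: K_verts_def)
      then show ?thesis by (simp add: power_0_left)
    qed
    show ?thesis
      by (subst sum.cong[OF refl *]) (auto simp: sum.inter_filter[symmetric] finite_support_graphs)
  qed
  ultimately show ?thesis by (simp add: power_add numeral_2_eq_2)
qed

section \<open>Supports of unit flows\<close>

lemma lookup_scaleR: "Poly_Mapping.lookup (c *\<^sub>R f) e = c *\<^sub>R Poly_Mapping.lookup f e"
proof -
  have "{i. c *\<^sub>R Poly_Mapping.lookup f i \<noteq> 0} \<subseteq> Poly_Mapping.keys f"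
    by (auto simp: in_keys_iff)
  then have "finite {i. c *\<^sub>R Poly_Mapping.lookup f i \<noteq> 0}"
    by (rule finite_subset) simp
  then show ?thesis by (simp add: scaleR_poly_mapping_def)
qed

lemma keys_scaleR_add_scaleR_subset:
  "Poly_Mapping.keys (u *\<^sub>R f + v *\<^sub>R g) \<subseteq> Poly_Mapping.keys f \<union> Poly_Mapping.keys g"
  by (auto simp: in_keys_iff lookup_add lookup_scaleR)

section \<open>Net outflow as a linear functional\<close>

definition net_outflow :: "nat \<Rightarrow> ((nat \<times> nat) \<Rightarrow>\<^sub>0 real) \<Rightarrow> nat \<Rightarrow> real" where
  "net_outflow n f i = (\<Sum>j \<in> {i<..n + 1}. Poly_Mapping.lookup f (i, j)) -
     (\<Sum>k \<in> {1..<i}. Poly_Mapping.lookup f (k, i))"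

lemma net_outflow_add: "net_outflow n (f + g) i = net_outflow n f i + net_outflow n g i"
  by (simp add: net_outflow_def lookup_add sum.distrib)

lemma net_outflow_diff: "net_outflow n (f - g) i = net_outflow n f i - net_outflow n g i"
  by (simp add: net_outflow_def lookup_minus sum_subtractf)

lemma net_outflow_scaleR: "net_outflow n (c *\<^sub>R f) i = c * net_outflow n f i"
  by (simp add: net_outflow_def lookup_scaleR sum_distrib_left right_diff_distrib)

lemma net_outflow_zero: "net_outflow n 0 i = 0"
  by (simp add: net_outflow_def)

lemma net_outflow_sum: "net_outflow n (\<Sum>a\<in>A. f a) i = (\<Sum>a\<in>A. net_outflow n (f a) i)"
  by (induction A rule: infinite_finite_induct) (simp_all add: net_outflow_zero net_outflow_add)

lemma net_outflow_single:
  assumes "(v, w) \<in> K_edges n" and "i \<in> {1..n}"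
  shows "net_outflow n (Poly_Mapping.single (v, w) c) i
    = (if i = v then c else 0) - (if i = w then c else 0)"
proof -
  have eq: "Poly_Mapping.lookup (Poly_Mapping.single (v, w) c) (a, b)
      = (if b = w then if a = v then c else 0 else 0)"
    "Poly_Mapping.lookup (Poly_Mapping.single (v, w) c) (a, b)
      = (if a = v then if b = w then c else 0 else 0)" for a b
    by (auto simp: lookup_single when_def)
  have "(\<Sum>j \<in> {i<..n + 1}. Poly_Mapping.lookup (Poly_Mapping.single (v, w) c) (i, j))
      = (if i = v then c else 0)"
    unfolding eq(1) using assms by (auto simp: sum.delta K_edges_def)
  moreover have "(\<Sum>k \<in> {1..<i}. Poly_Mapping.lookup (Poly_Mapping.single (v, w) c) (k, i))
      = (if i = w then c else 0)"
    unfolding eq(2) using assms by (auto simp: sum.delta K_edges_def)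
  ultimately show ?thesis by (simp add: net_outflow_def)
qed

lemma CRY_iff:
  "f \<in> CRY n \<longleftrightarrow> Poly_Mapping.keys f \<subseteq> K_edges n \<and> (\<forall>e. 0 \<le> Poly_Mapping.lookup f e) \<and>
     (\<forall>i \<in> {1..n}. net_outflow n f i = (if i = 1 then 1 else 0))"
proof -
  have "(\<forall>e \<in> K_edges n. 0 \<le> Poly_Mapping.lookup f e) \<longleftrightarrow> (\<forall>e. 0 \<le> Poly_Mapping.lookup f e)"
    if "Poly_Mapping.keys f \<subseteq> K_edges n"
    using that by (metis in_keys_iff order_refl subsetD)
  then show ?thesis unfolding CRY_def unit_flow_def net_outflow_def mem_Collect_eq by blast
qed

lemma CRY_nonneg: "f \<in> CRY n \<Longrightarrow> 0 \<le> Poly_Mapping.lookup f e"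
  unfolding CRY_iff by blast

lemma CRY_keys_subset: "f \<in> CRY n \<Longrightarrow> Poly_Mapping.keys f \<subseteq> K_edges n"
  unfolding CRY_iff by blast

lemma CRY_keys_iff: "f \<in> CRY n \<Longrightarrow> e \<in> Poly_Mapping.keys f \<longleftrightarrow> 0 < Poly_Mapping.lookup f e"
  unfolding CRY_iff in_keys_iff less_le by metis

lemma valid_subgraph_iff_keys: "valid_subgraph n H \<longleftrightarrow> (\<exists>f \<in> CRY n. H = Poly_Mapping.keys f)"
proof -
  have "{e \<in> K_edges n. Poly_Mapping.lookup f e > 0} = Poly_Mapping.keys f" if "f \<in> CRY n" for f
    using that CRY_keys_iff[OF that] by (auto simp: CRY_iff)
  then show ?thesis by (auto simp: valid_subgraph_def CRY_def)
qed

text \<open>Flow values are nonnegative, so a total inflow or outflow vanishes iff there is no edge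
  carrying it. Conservation then makes heads and tails agree at internal vertices, and the unit
  outflow makes vertex 1 a tail.\<close>

lemma keys_in_support_graphs:
  assumes f: "f \<in> CRY n" and n: "n \<ge> 1"
  shows "Poly_Mapping.keys f \<in> support_graphs n"
proof -
  let ?H = "Poly_Mapping.keys f"
  note F = f[unfolded CRY_iff]
  have sub: "?H \<subseteq> K_edges n" using F by simp
  have out: "i \<in> fst ` ?H \<longleftrightarrow> (\<Sum>j \<in> {i<..n + 1}. Poly_Mapping.lookup f (i, j)) \<noteq> 0" for i
  proof -
    have "(\<Sum>j \<in> {i<..n + 1}. Poly_Mapping.lookup f (i, j)) = 0
        \<longleftrightarrow> (\<forall>j \<in> {i<..n + 1}. Poly_Mapping.lookup f (i, j) = 0)"
      using F by (intro sum_nonneg_eq_0_iff) auto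
    moreover have "i \<in> fst ` ?H \<longleftrightarrow> (\<exists>j \<in> {i<..n + 1}. (i, j) \<in> ?H)"
      using sub by (force simp: K_edges_def image_iff)
    ultimately show ?thesis unfolding in_keys_iff by blast
  qed
  have inn: "i \<in> snd ` ?H \<longleftrightarrow> (\<Sum>k \<in> {1..<i}. Poly_Mapping.lookup f (k, i)) \<noteq> 0" for i
  proof -
    have "(\<Sum>k \<in> {1..<i}. Poly_Mapping.lookup f (k, i)) = 0
        \<longleftrightarrow> (\<forall>k \<in> {1..<i}. Poly_Mapping.lookup f (k, i) = 0)"
      using F by (intro sum_nonneg_eq_0_iff) auto
    moreover have "i \<in> snd ` ?H \<longleftrightarrow> (\<exists>k \<in> {1..<i}. (k, i) \<in> ?H)"
      using sub by (force simp: K_edges_def image_iff)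
    ultimately show ?thesis unfolding in_keys_iff by blast
  qed
  have iff: "i \<in> fst ` ?H \<longleftrightarrow> i \<in> heads ?H" if i: "i \<in> {1..n}" for i
  proof (cases "i = 1")
    case True
    then have "(\<Sum>j \<in> {i<..n + 1}. Poly_Mapping.lookup f (i, j)) = 1"
      using F[THEN conjunct2, THEN conjunct2, rule_format, OF i] by (simp add: net_outflow_def)
    then show ?thesis using out[of i] True by (simp add: heads_def)
  next
    case False
    then have "(\<Sum>j \<in> {i<..n + 1}. Poly_Mapping.lookup f (i, j))
        = (\<Sum>k \<in> {1..<i}. Poly_Mapping.lookup f (k, i))"
      using F[THEN conjunct2, THEN conjunct2, rule_format, OF i] by (simp add: net_outflow_def)
    then show ?thesis using out[of i] inn[of i] False by (simp add: heads_def)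
  qed
  have tails: "fst ` ?H \<subseteq> {1..n}" using sub by (auto simp: K_edges_def)
  then have "fst ` ?H \<subseteq> heads ?H" using iff by blast
  then have root: "?H \<in> rooted_graphs n" using sub by (simp add: rooted_graphs_def)
  \<comment> \<open>No equation is imposed at the sink. It is a head because some dead end exists
    and no vertex in \<open>{1..n}\<close> can be one.\<close>
  then obtain v where v: "v \<in> heads ?H" "v \<notin> fst ` ?H" using heads_not_subset_tails by blast
  with iff[of v] subsetD[OF rooted_graphsD(5)[OF root], of v] have "v = n + 1" by fastforce
  have "i \<in> heads ?H \<longleftrightarrow> i \<in> insert (n + 1) (fst ` ?H)" for i
  proof (cases "i \<in> {1..n}")
    case False
    then have "i \<in> heads ?H \<longrightarrow> i = n + 1"
      using subsetD[OF rooted_graphsD(5)[OF root], of i] by fastforce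
    with False tails v \<open>v = n + 1\<close> show ?thesis by blast
  qed (use iff in auto)
  then have "heads ?H = insert (n + 1) (fst ` ?H)" by blast
  with sub show ?thesis by (simp add: support_graphs_def)
qed

text \<open>The inflow at each vertex, when every vertex splits its inflow evenly among its out-edges.\<close>

function throughput :: "(nat \<times> nat) set \<Rightarrow> nat \<Rightarrow> real" where
  "throughput H j = (if j = 1 then 1
     else \<Sum>i | i < j \<and> (i, j) \<in> H. throughput H i / card {k. (i, k) \<in> H})"
  by pat_completeness auto
termination by (relation "Wellfounded.measure snd") auto

declare throughput.simps [simp del]

lemma support_graphsD:
  assumes "H \<in> support_graphs n"
  shows "H \<subseteq> K_edges n" "finite H" "insert (n + 1) (fst ` H) = heads H" "H \<in> rooted_graphs n"
    "n + 1 \<notin> fst ` H" "finite (heads H)" "card (heads H) = Suc (card (fst ` H))"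
proof -
  show *: "H \<subseteq> K_edges n" "finite H" "insert (n + 1) (fst ` H) = heads H" "H \<in> rooted_graphs n"
    using assms by (auto simp: support_graphs_def rooted_graphs_def K_edges_finite_subset)
  show "n + 1 \<notin> fst ` H" using *(1) by (auto simp: K_edges_def)
  then show "finite (heads H)" "card (heads H) = Suc (card (fst ` H))"
    using *(2) unfolding *(3)[symmetric] by simp_all
qed

lemma finite_out_neighbours: "finite H \<Longrightarrow> finite {k. (i, k) \<in> H}"
  by (rule finite_subset[of _ "snd ` H"]) (auto intro: rev_image_eqI)

text \<open>A head other than 1 has an in-edge, and the tail of that edge is a smaller head, so
  positivity propagates along the vertex order.\<close>

lemma throughput_pos:
  assumes H: "H \<in> support_graphs n"
  shows "v \<in> heads H \<Longrightarrow> 0 < throughput H v"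
proof (induction v rule: less_induct)
  case (less v)
  note D = support_graphsD[OF H]
  show ?case
  proof (cases "v = 1")
    case True
    then show ?thesis by (simp add: throughput.simps)
  next
    case False
    with less.prems obtain i0 where i0: "(i0, v) \<in> H" by (auto simp: heads_def)
    have "0 < throughput H i / card {k. (i, k) \<in> H}" if "i < v" "(i, v) \<in> H" for i
    proof -
      have "i \<in> heads H" using that D(3) by force
      moreover have "card {k. (i, k) \<in> H} > 0"
        using that finite_out_neighbours[OF D(2)] by (auto simp: card_gt_0_iff)
      ultimately show ?thesis using less.IH that by simp
    qed
    moreover have "i0 < v" using i0 D(1) by (auto simp: K_edges_def)
    ultimately have "0 < (\<Sum>i | i < v \<and> (i, v) \<in> H. throughput H i / card {k. (i, k) \<in> H})"
      using i0 by (intro sum_pos) auto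
    then show ?thesis using False by (simp add: throughput.simps)
  qed
qed

lemma exists_flow_with_support:
  assumes H: "H \<in> support_graphs n" and n: "n \<ge> 1"
  shows "\<exists>f \<in> CRY n. Poly_Mapping.keys f = H"
proof -
  note D = support_graphsD[OF H]
  define deg where "deg i = card {k. (i, k) \<in> H}" for i
  \<comment> \<open>Each edge carries an equal share of the throughput of its tail. The shares
    leaving a tail add up to its throughput, and the recursion for \<open>throughput\<close> makes
    the inflow the same number.\<close>
  define g where "g e = (if e \<in> H then throughput H (fst e) / deg (fst e) else 0)" for e
  define f where "f = Abs_poly_mapping g"
  have deg_pos: "0 < deg i" if "(i, j) \<in> H" for i j
    using that finite_out_neighbours[OF D(2)] by (auto simp: card_gt_0_iff deg_def)
  have g_pos: "0 < g e" if "e \<in> H" for e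
  proof -
    have "fst e \<in> heads H" using that D(3) by auto
    then show ?thesis
      using that throughput_pos[OF H] deg_pos[of "fst e" "snd e"] by (simp add: g_def)
  qed
  have "g e \<noteq> 0 \<longleftrightarrow> e \<in> H" for e
    using g_pos[of e] g_def[of e] by (metis less_irrefl)
  then have supp: "{e. g e \<noteq> 0} = H" by blast
  then have lf: "Poly_Mapping.lookup f = g"
    using D(2) unfolding f_def by (intro lookup_Abs_poly_mapping) simp
  have keys: "Poly_Mapping.keys f = H" using supp unfolding lf[symmetric] by (auto simp: in_keys_iff)
  have out: "(\<Sum>j \<in> {i<..n + 1}. g (i, j)) = (if i \<in> fst ` H then throughput H i else 0)" for i
  proof -
    have "(\<Sum>j \<in> {i<..n + 1}. g (i, j)) = (\<Sum>j | (i, j) \<in> H. throughput H i / deg i)"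
      using D(1) finite_out_neighbours[OF D(2)]
      by (intro sum.mono_neutral_cong_right) (auto simp: g_def K_edges_def)
    also have "\<dots> = deg i * (throughput H i / deg i)" by (simp add: deg_def)
    also have "\<dots> = (if i \<in> fst ` H then throughput H i else 0)"
    proof (cases "i \<in> fst ` H")
      case True
      then have "deg i > 0" using deg_pos by auto
      with True show ?thesis by simp
    next
      case False
      then have "{k. (i, k) \<in> H} = {}" by force
      then have "deg i = 0" by (simp add: deg_def)
      with False show ?thesis by simp
    qed
    finally show ?thesis .
  qed
  have inn: "(\<Sum>k \<in> {1..<i}. g (k, i)) = throughput H i" if "i \<noteq> 1" for i
  proof -
    have "(\<Sum>k \<in> {1..<i}. g (k, i)) = (\<Sum>k | k < i \<and> (k, i) \<in> H. throughput H k / deg k)"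
      using D(1) by (intro sum.mono_neutral_cong_right) (auto simp: g_def K_edges_def)
    then show ?thesis using that by (simp add: throughput.simps[of H i] deg_def)
  qed
  have "net_outflow n f i = (if i = 1 then 1 else 0)" if i: "i \<in> {1..n}" for i
  proof (cases "i = 1")
    case True
    have "1 \<in> insert (n + 1) (fst ` H)" unfolding D(3) by (simp add: heads_def)
    then have "1 \<in> fst ` H" using n by simp
    then have "(\<Sum>j \<in> {i<..n + 1}. g (i, j)) = 1"
      unfolding out True by (simp add: throughput.simps)
    then show ?thesis by (simp add: net_outflow_def lf True)
  next
    case False
    \<comment> \<open>A vertex of \<open>{1..n}\<close> that is not a tail is not a head either, so
      nothing flows into it.\<close>
    have "throughput H i = 0" if "i \<notin> fst ` H"
    proof -
      have "i \<notin> heads H" using that i unfolding D(3)[symmetric] by simp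
      with False have "{k. k < i \<and> (k, i) \<in> H} = {}" by (force simp: heads_def)
      then show ?thesis using False by (simp only: throughput.simps[of H i]) simp
    qed
    then show ?thesis
      unfolding net_outflow_def lf out inn[OF False] using False by simp
  qed
  moreover have "0 \<le> g e" for e using g_pos[of e] by (cases "e \<in> H") (auto simp: g_def)
  ultimately have "f \<in> CRY n" using D(1) keys by (simp add: CRY_iff lf)
  with keys show ?thesis by blast
qed

section \<open>Valid and primitive subgraphs in terms of support graphs\<close>

lemma valid_subgraph_iff_support_graph:
  "n \<ge> 1 \<Longrightarrow> valid_subgraph n H \<longleftrightarrow> H \<in> support_graphs n"
  using keys_in_support_graphs exists_flow_with_support unfolding valid_subgraph_iff_keys by blast

lemma verts_eq_heads:
  assumes "H \<in> support_graphs n" and "n \<ge> 1"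
  shows "verts H = heads H"
proof -
  note D = support_graphsD[OF assms(1)]
  have "1 \<in> insert (n + 1) (fst ` H)" unfolding D(3) by (simp add: heads_def)
  then have "1 \<in> fst ` H" using assms by auto
  moreover have "fst ` H \<subseteq> heads H" using D(3) by blast
  ultimately show ?thesis by (auto simp: verts_def heads_def)
qed

text \<open>Following out-edges increases the index until the sink is reached, so all vertices lie
  in one component.\<close>

lemma linked_support_graph:
  assumes H: "H \<in> support_graphs n" and n: "n \<ge> 1"
  shows "linked H = verts H \<times> verts H"
proof -
  note D = support_graphsD[OF H]
  have to_sink: "(v, n + 1) \<in> (H \<union> H\<inverse>)\<^sup>*" if "v \<in> heads H" for v
    using that
  proof (induction "n + 1 - v" arbitrary: v rule: less_induct)
    case less
    show ?case
    proof (cases "v = n + 1")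
      case False
      with less.prems D(3) obtain w where w: "(v, w) \<in> H" by force
      then have "w \<in> heads H" "v < w" "w \<le> n + 1"
        using D(1) by (force simp: heads_def K_edges_def)+
      then have "(w, n + 1) \<in> (H \<union> H\<inverse>)\<^sup>*" by (intro less.hyps) auto
      with w show ?thesis by (meson UnI1 converse_rtrancl_into_rtrancl)
    qed simp
  qed
  have "sym ((H \<union> H\<inverse>)\<^sup>*)" by (intro sym_rtrancl sym_Un_converse)
  then have "(u, v) \<in> (H \<union> H\<inverse>)\<^sup>*" if "u \<in> heads H" "v \<in> heads H" for u v
    using to_sink[OF that(1)] to_sink[OF that(2)] by (meson rtrancl_trans symD)
  then show ?thesis by (auto simp: linked_def verts_eq_heads[OF H n])
qed

lemma betti1_support_graph:
  assumes H: "H \<in> support_graphs n" and n: "n \<ge> 1"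
  shows "betti1 H = int (card H) - int (card (heads H)) + 1"
proof -
  have "verts H \<noteq> {}" by (simp add: verts_eq_heads[OF H n] heads_def)
  then have "components_of_graph H = {verts H}"
    unfolding components_of_graph_def linked_support_graph[OF H n] by (auto simp: quotient_def)
  then show ?thesis by (simp add: betti1_def verts_eq_heads[OF H n])
qed

text \<open>Support graphs are always connected, so only the condition on the vertex set
  remains.\<close>

lemma primitive_subgraph_iff:
  assumes H: "H \<in> support_graphs n" and n: "n \<ge> 1"
  shows "primitive_subgraph n H \<longleftrightarrow> heads H = K_verts n"
  using verts_eq_heads[OF H n]
  by (auto simp: primitive_subgraph_def connected_graph_def linked_support_graph[OF H n] heads_def)

section \<open>Faces of the flow polytope\<close>

lemma CRY_convex_combination:
  assumes "f \<in> CRY n" "g \<in> CRY n" "0 \<le> u" "0 \<le> v" "u + v = 1"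
  shows "u *\<^sub>R f + v *\<^sub>R g \<in> CRY n"
proof -
  note f = assms(1)[unfolded CRY_iff] and g = assms(2)[unfolded CRY_iff]
  have "Poly_Mapping.keys (u *\<^sub>R f + v *\<^sub>R g) \<subseteq> K_edges n"
    using f g keys_scaleR_add_scaleR_subset[of u f v g] by blast
  moreover have "0 \<le> Poly_Mapping.lookup (u *\<^sub>R f + v *\<^sub>R g) e" for e
    using CRY_nonneg[OF assms(1), of e] CRY_nonneg[OF assms(2), of e] assms(3,4)
    by (simp add: lookup_add lookup_scaleR)
  moreover have "net_outflow n (u *\<^sub>R f + v *\<^sub>R g) i = (if i = 1 then 1 else 0)" if "i \<in> {1..n}" for i
  proof -
    have "net_outflow n f i = (if i = 1 then 1 else 0)" "net_outflow n g i = (if i = 1 then 1 else 0)"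
      using f g that by blast+
    then show ?thesis using assms(5) by (simp add: net_outflow_add net_outflow_scaleR)
  qed
  ultimately show ?thesis by (simp add: CRY_iff)
qed

text \<open>Nonnegative values cannot cancel.\<close>

lemma CRY_keys_convex_combination:
  assumes "f \<in> CRY n" "g \<in> CRY n" "0 < u" "0 < v"
  shows "Poly_Mapping.keys (u *\<^sub>R f + v *\<^sub>R g) = Poly_Mapping.keys f \<union> Poly_Mapping.keys g"
proof -
  have "0 \<le> Poly_Mapping.lookup f e" "0 \<le> Poly_Mapping.lookup g e" for e
    using assms CRY_nonneg by blast+
  then show ?thesis
    using assms(3,4) by (auto simp: in_keys_iff lookup_add lookup_scaleR add_nonneg_eq_0_iff)
qed

section \<open>Faces cut out by edge sets\<close>

definition supported_flows :: "nat \<Rightarrow> (nat \<times> nat) set \<Rightarrow> ((nat \<times> nat) \<Rightarrow>\<^sub>0 real) set" where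
  "supported_flows n H = {f \<in> CRY n. Poly_Mapping.keys f \<subseteq> H}"

text \<open>The support of a point inside a segment is the union of the supports of the endpoints,
  so it lies in \<open>H\<close> only if both of these do.\<close>

lemma supported_flows_face_of: "supported_flows n H face_of CRY n"
  unfolding face_of_def
proof (intro conjI ballI impI)
  show "supported_flows n H \<subseteq> CRY n" by (auto simp: supported_flows_def)
  show "convex (supported_flows n H)"
  proof (rule convexI)
    fix f g :: "(nat \<times> nat) \<Rightarrow>\<^sub>0 real" and u v :: real
    assume "f \<in> supported_flows n H" "g \<in> supported_flows n H" "0 \<le> u" "0 \<le> v" "u + v = 1"
    moreover note keys_scaleR_add_scaleR_subset[of u f v g]
    moreover note CRY_convex_combination[of f n g u v]
    ultimately show "u *\<^sub>R f + v *\<^sub>R g \<in> supported_flows n H"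
      unfolding supported_flows_def mem_Collect_eq by blast
  qed
next
  fix f g h assume fg: "f \<in> CRY n" "g \<in> CRY n" and h: "h \<in> supported_flows n H" "h \<in> open_segment f g"
  then obtain u where u: "0 < u" "u < 1" "h = (1 - u) *\<^sub>R f + u *\<^sub>R g"
    by (auto simp: in_segment)
  then have "Poly_Mapping.keys f \<union> Poly_Mapping.keys g = Poly_Mapping.keys h"
    using CRY_keys_convex_combination[OF fg, of "1 - u" u] by simp
  then show "f \<in> supported_flows n H" "g \<in> supported_flows n H"
    using fg h by (auto simp: supported_flows_def)
qed

text \<open>On its support \<open>g\<close> is positive, so a small step along \<open>z\<close>
  stays nonnegative, and \<open>z\<close> does not disturb conservation.\<close>

lemma CRY_perturb:
  assumes g: "g \<in> CRY n" and z: "Poly_Mapping.keys z \<subseteq> Poly_Mapping.keys g"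
    "\<And>i. i \<in> {1..n} \<Longrightarrow> net_outflow n z i = 0"
  shows "\<exists>\<epsilon>>0. g + \<epsilon> *\<^sub>R z \<in> supported_flows n (Poly_Mapping.keys g)"
proof -
  note G = g[unfolded CRY_iff]
  let ?r = "\<lambda>e. Poly_Mapping.lookup g e / (1 + \<bar>Poly_Mapping.lookup z e\<bar>)"
  \<comment> \<open>The \<open>1\<close> inserted bounds the step even for an empty support, and the
    \<open>1 +\<close> in \<open>?r\<close> avoids division by zero where \<open>z\<close>
    vanishes.\<close>
  define \<epsilon> where "\<epsilon> = Min (insert 1 (?r ` Poly_Mapping.keys g))"
  have pos: "0 < \<epsilon>"
    unfolding \<epsilon>_def using CRY_keys_iff[OF g] by (subst Min_gr_iff) (auto simp: add_pos_nonneg)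
  have "0 \<le> Poly_Mapping.lookup (g + \<epsilon> *\<^sub>R z) e" for e
  proof (cases "e \<in> Poly_Mapping.keys g")
    case True
    then have "\<epsilon> \<le> ?r e" by (auto simp: \<epsilon>_def)
    then have "\<epsilon> * (1 + \<bar>Poly_Mapping.lookup z e\<bar>) \<le> Poly_Mapping.lookup g e"
      by (simp add: pos_le_divide_eq add_pos_nonneg)
    moreover have "- (\<epsilon> * Poly_Mapping.lookup z e) \<le> \<epsilon> * (1 + \<bar>Poly_Mapping.lookup z e\<bar>)"
      using mult_left_mono[of "- Poly_Mapping.lookup z e" "1 + \<bar>Poly_Mapping.lookup z e\<bar>" \<epsilon>] pos by simp
    ultimately show ?thesis by (simp add: lookup_add lookup_scaleR)
  next
    case False
    with z(1) have "e \<notin> Poly_Mapping.keys z" by blast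
    with False show ?thesis by (simp add: lookup_add lookup_scaleR in_keys_iff)
  qed
  moreover have keys: "Poly_Mapping.keys (g + \<epsilon> *\<^sub>R z) \<subseteq> Poly_Mapping.keys g"
    using z(1) keys_scaleR_add_scaleR_subset[of 1 g \<epsilon> z] by auto
  ultimately have "g + \<epsilon> *\<^sub>R z \<in> supported_flows n (Poly_Mapping.keys g)"
    using G z(2) by (auto simp: supported_flows_def CRY_iff net_outflow_add net_outflow_scaleR)
  with pos show ?thesis by blast
qed

text \<open>Take \<open>g\<close> in \<open>F\<close> with maximal support. Averaging shows that its
  support contains all others in \<open>F\<close>. Conversely, a segment from a flow
  \<open>f\<close> supported there can be prolonged beyond \<open>g\<close> inside the polytope, and
  the face property at \<open>g\<close> puts \<open>f\<close> into \<open>F\<close>.\<close>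

lemma face_of_CRY_obtain_keys:
  assumes F: "F face_of CRY n" and "F \<noteq> {}"
  obtains g where "g \<in> CRY n" "F = supported_flows n (Poly_Mapping.keys g)"
proof -
  have FC: "F \<subseteq> CRY n" and conv: "convex F" using F by (auto simp: face_of_def)
  have "Poly_Mapping.keys ` F \<subseteq> Pow (K_edges n)" using FC CRY_keys_subset by blast
  then have "finite (Poly_Mapping.keys ` F)" by (rule finite_subset) (simp add: finite_K_edges)
  from finite_has_maximal[OF this] obtain g
    where g: "g \<in> F" and max: "\<And>f. f \<in> F \<Longrightarrow> Poly_Mapping.keys g \<subseteq> Poly_Mapping.keys f
      \<Longrightarrow> Poly_Mapping.keys g = Poly_Mapping.keys f"
    using assms(2) by auto
  have gC: "g \<in> CRY n" using g FC by blast
  have "F \<subseteq> supported_flows n (Poly_Mapping.keys g)"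
  proof
    fix f assume f: "f \<in> F"
    have "(1/2) *\<^sub>R f + (1/2) *\<^sub>R g \<in> F" using conv f g by (auto intro: convexD)
    moreover have "Poly_Mapping.keys ((1/2) *\<^sub>R f + (1/2) *\<^sub>R g) = Poly_Mapping.keys f \<union> Poly_Mapping.keys g"
      using f FC gC by (intro CRY_keys_convex_combination) auto
    ultimately have "Poly_Mapping.keys g = Poly_Mapping.keys f \<union> Poly_Mapping.keys g"
      using max by (metis Un_upper2)
    then show "f \<in> supported_flows n (Poly_Mapping.keys g)"
      using f FC by (auto simp: supported_flows_def)
  qed
  moreover have "f \<in> F" if f: "f \<in> supported_flows n (Poly_Mapping.keys g)" for f
  proof (cases "f = g")
    case True
    with g show ?thesis by simp
  next
    case False
    have fC: "f \<in> CRY n" and fk: "Poly_Mapping.keys f \<subseteq> Poly_Mapping.keys g"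
      using f by (auto simp: supported_flows_def)
    have "Poly_Mapping.keys (g - f) \<subseteq> Poly_Mapping.keys g" using keys_diff[of g f] fk by blast
    moreover have "net_outflow n (g - f) i = 0" if "i \<in> {1..n}" for i
      using fC[unfolded CRY_iff] gC[unfolded CRY_iff] that by (simp only: net_outflow_diff)
    ultimately obtain \<epsilon> where eps: "\<epsilon> > 0" "g + \<epsilon> *\<^sub>R (g - f) \<in> supported_flows n (Poly_Mapping.keys g)"
      using CRY_perturb[OF gC] by blast
    \<comment> \<open>\<open>?h\<close> lies beyond \<open>g\<close> as seen from \<open>f\<close>,
      and \<open>?u\<close> is the parameter at which the segment from \<open>f\<close> to
      \<open>?h\<close> passes through \<open>g\<close>.\<close>
    let ?h = "g + \<epsilon> *\<^sub>R (g - f)" and ?u = "1 / (1 + \<epsilon>)"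
    have convex_combination_eq: "(1 - u) *\<^sub>R f + u *\<^sub>R h = f + u *\<^sub>R (h - f)"
      for u :: real and h
      by (simp add: algebra_simps)
    have "?h - f = (1 + \<epsilon>) *\<^sub>R (g - f)" by (simp add: algebra_simps)
    then have ne: "f \<noteq> ?h" using False eps(1) by auto
    have "f + ?u *\<^sub>R (?h - f) = g"
      unfolding \<open>?h - f = _\<close> using eps(1) by simp
    then have "g = (1 - ?u) *\<^sub>R f + ?u *\<^sub>R ?h" by (metis convex_combination_eq)
    moreover have "0 < ?u" "?u < 1" using eps(1) by auto
    ultimately have "g \<in> open_segment f ?h" using ne unfolding in_segment by blast
    moreover have "?h \<in> CRY n" using eps(2) by (simp add: supported_flows_def)
    ultimately show ?thesis using F fC g by (auto simp: face_of_def)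
  qed
  ultimately have "F = supported_flows n (Poly_Mapping.keys g)" by blast
  with gC show ?thesis by (rule that)
qed

lemma faces_of_CRY:
  assumes n: "n \<ge> 1"
  shows "{F. F face_of CRY n} = insert {} (supported_flows n ` support_graphs n)"
proof -
  have "F \<in> supported_flows n ` support_graphs n" if F: "F face_of CRY n" "F \<noteq> {}" for F
  proof -
    obtain g where "g \<in> CRY n" "F = supported_flows n (Poly_Mapping.keys g)"
      using face_of_CRY_obtain_keys[OF F] by metis
    then show ?thesis using keys_in_support_graphs[OF _ n] by simp
  qed
  then show ?thesis by (auto simp: supported_flows_face_of)
qed

text \<open>Some flow has support exactly \<open>H\<close>, so the face determines
  \<open>H\<close>.\<close>

lemma inj_on_supported_flows:
  assumes n: "n \<ge> 1"
  shows "inj_on (supported_flows n) (support_graphs n)"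
proof -
  have "H \<subseteq> H'" if H: "H \<in> support_graphs n" and eq: "supported_flows n H = supported_flows n H'" for H H'
  proof -
    from exists_flow_with_support[OF H n] obtain f where "f \<in> CRY n" "Poly_Mapping.keys f = H" by blast
    then have "f \<in> supported_flows n H'" unfolding eq[symmetric] by (simp add: supported_flows_def)
    with \<open>Poly_Mapping.keys f = H\<close> show ?thesis by (simp add: supported_flows_def)
  qed
  then show ?thesis by (intro inj_onI subset_antisym) auto
qed

section \<open>Dimension of the faces\<close>

definition circulations :: "nat \<Rightarrow> (nat \<times> nat) set \<Rightarrow> ((nat \<times> nat) \<Rightarrow>\<^sub>0 real) set" where
  "circulations n H = {z. Poly_Mapping.keys z \<subseteq> H \<and> (\<forall>i \<in> {1..n}. net_outflow n z i = 0)}"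

text \<open>A difference of unit flows is a circulation. Conversely, a flow with support exactly
  \<open>H\<close> can be moved a little along any circulation, which is therefore a multiple of a
  difference.\<close>

lemma span_differences_supported_flows:
  assumes H: "H \<in> support_graphs n" and n: "n \<ge> 1"
  shows "span {x - y | x y. x \<in> supported_flows n H \<and> y \<in> supported_flows n H} = span (circulations n H)"
proof (rule span_eq[THEN iffD2], intro conjI)
  let ?D = "{x - y | x y. x \<in> supported_flows n H \<and> y \<in> supported_flows n H}"
  have "?D \<subseteq> circulations n H"
  proof clarify
    fix x y assume "x \<in> supported_flows n H" "y \<in> supported_flows n H"
    then show "x - y \<in> circulations n H"
      using keys_diff[of x y] unfolding circulations_def supported_flows_def CRY_iff
      by (auto simp: net_outflow_diff)
  qed
  then show "?D \<subseteq> span (circulations n H)" using span_superset by blast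
  obtain g where g: "g \<in> CRY n" "Poly_Mapping.keys g = H"
    using exists_flow_with_support[OF H n] by blast
  show "circulations n H \<subseteq> span ?D"
  proof
    fix z assume "z \<in> circulations n H"
    then obtain \<epsilon> where eps: "\<epsilon> > 0" "g + \<epsilon> *\<^sub>R z \<in> supported_flows n H"
      using CRY_perturb[OF g(1), of z] g(2) by (auto simp: circulations_def)
    have "g \<in> supported_flows n H" using g by (simp add: supported_flows_def)
    with eps(2) have "(g + \<epsilon> *\<^sub>R z) - g \<in> ?D" by blast
    then have "(1 / \<epsilon>) *\<^sub>R ((g + \<epsilon> *\<^sub>R z) - g) \<in> span ?D" by (intro span_mul span_base)
    with eps(1) show "z \<in> span ?D" by simp
  qed
qed

text \<open>
  Choosing one out-edge at every non-sink vertex of \<open>H\<close> gives a tree directed towards the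
  sink; its fundamental cycles form a basis of the circulations.
\<close>

lemma dim_circulations:
  assumes H: "H \<in> support_graphs n"
  shows "int (dim (circulations n H)) = int (card H) - int (card (heads H)) + 1"
proof -
  note D = support_graphsD[OF H]
  have "\<forall>v \<in> fst ` H. \<exists>w. (v, w) \<in> H" by auto
  then obtain s where s: "\<And>v. v \<in> fst ` H \<Longrightarrow> (v, s v) \<in> H" by metis
  define T where "T = (\<lambda>v. (v, s v)) ` fst ` H"
  have TH: "T \<subseteq> H" using s by (auto simp: T_def)
  have cardT: "card T = card (fst ` H)" unfolding T_def by (rule card_image) (auto simp: inj_on_def)
  have in_heads: "j \<in> heads H" "i \<in> heads H" "i < j" "j \<le> n + 1" if "(i, j) \<in> H" for i j
    using that D(1,3) by (force simp: heads_def K_edges_def)+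
  \<comment> \<open>\<open>p\<close> is the unit flow along the tree path from \<open>v\<close> to
    the sink. For \<open>v = n + 1\<close> it is \<open>0\<close>, since the sink is outside
    \<open>{1..n}\<close>.\<close>
  have path: "\<exists>p. Poly_Mapping.keys p \<subseteq> T \<and>
      (\<forall>i \<in> {1..n}. net_outflow n p i = (if i = v then 1 else 0))" if "v \<in> heads H" for v
    using that
  proof (induction "n + 1 - v" arbitrary: v rule: less_induct)
    case less
    show ?case
    proof (cases "v = n + 1")
      case True
      then show ?thesis by (intro exI[of _ 0]) (auto simp: net_outflow_zero)
    next
      case False
      with less.prems D(3) have v: "v \<in> fst ` H" by blast
      note e = s[OF v]
      have "s v \<in> heads H" "n + 1 - s v < n + 1 - v" using in_heads[OF e] by auto
      from less.hyps[OF this(2,1)] obtain p where p: "Poly_Mapping.keys p \<subseteq> T"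
        "\<And>i. i \<in> {1..n} \<Longrightarrow> net_outflow n p i = (if i = s v then 1 else 0)" by blast
      have "Poly_Mapping.keys (Poly_Mapping.single (v, s v) (1::real) + p) \<subseteq> T"
        using keys_add[of "Poly_Mapping.single (v, s v) (1::real)" p] p(1) v by (auto simp: T_def)
      moreover have "net_outflow n (Poly_Mapping.single (v, s v) 1 + p) i = (if i = v then 1 else 0)"
        if "i \<in> {1..n}" for i
        using net_outflow_single[OF subsetD[OF D(1) e] that] p(2)[OF that] by (simp add: net_outflow_add)
      ultimately show ?thesis by blast
    qed
  qed
  \<comment> \<open>The fundamental cycle of \<open>e = (v, w)\<close>: the edge itself, then the
    tree path from \<open>w\<close> to the sink, minus the tree path from \<open>v\<close>.\<close>
  have cycle: "\<exists>z \<in> circulations n H. \<forall>e' \<in> H - T. Poly_Mapping.lookup z e' = (if e' = e then 1 else 0)"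
    if e: "e \<in> H - T" for e
  proof -
    obtain v w where vw: "e = (v, w)" by (cases e)
    then have "(v, w) \<in> H" using e by simp
    obtain p where p: "Poly_Mapping.keys p \<subseteq> T"
      "\<And>i. i \<in> {1..n} \<Longrightarrow> net_outflow n p i = (if i = v then 1 else 0)"
      using path in_heads(2)[OF \<open>(v, w) \<in> H\<close>] by blast
    obtain q where q: "Poly_Mapping.keys q \<subseteq> T"
      "\<And>i. i \<in> {1..n} \<Longrightarrow> net_outflow n q i = (if i = w then 1 else 0)"
      using path in_heads(1)[OF \<open>(v, w) \<in> H\<close>] by blast
    let ?z = "Poly_Mapping.single e 1 + (q - p)"
    have "net_outflow n ?z i = 0" if "i \<in> {1..n}" for i
      using net_outflow_single[OF subsetD[OF D(1) \<open>(v, w) \<in> H\<close>] that, of 1] p(2)[OF that] q(2)[OF that]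
      by (simp add: net_outflow_add net_outflow_diff vw)
    moreover have "Poly_Mapping.keys ?z \<subseteq> H"
    proof -
      have "Poly_Mapping.keys ?z \<subseteq> insert e (Poly_Mapping.keys q \<union> Poly_Mapping.keys p)"
        using keys_add[of "Poly_Mapping.single e (1::real)" "q - p"] keys_diff[of q p] by auto
      then show ?thesis using e p(1) q(1) TH by blast
    qed
    moreover have "Poly_Mapping.lookup ?z e' = (if e' = e then 1 else 0)" if "e' \<in> H - T" for e'
    proof -
      have "Poly_Mapping.lookup p e' = 0" "Poly_Mapping.lookup q e' = 0"
        using that p(1) q(1) by (auto simp: in_keys_iff)
      then show ?thesis by (simp add: lookup_add lookup_minus lookup_single when_def)
    qed
    ultimately show ?thesis by (auto simp: circulations_def)
  qed
  \<comment> \<open>Going up the vertices, the inflow at \<open>v\<close> is already zero and at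
    most one tree edge leaves \<open>v\<close>, so conservation forces its value to be zero.\<close>
  have tree_zero: "z = 0" if z: "z \<in> circulations n H" "Poly_Mapping.keys z \<subseteq> T" for z
  proof -
    have "Poly_Mapping.lookup z (v, w) = 0" for v w
    proof (induction v arbitrary: w rule: less_induct)
      case (less v)
      show ?case
      proof (rule ccontr)
        assume "Poly_Mapping.lookup z (v, w) \<noteq> 0"
        then have "(v, w) \<in> T" using z(2) by (auto simp: in_keys_iff)
        then have w: "w = s v" and vw: "(v, w) \<in> K_edges n" using TH D(1) by (auto simp: T_def)
        then have v: "v \<in> {1..n}" by (auto simp: K_edges_def)
        have "Poly_Mapping.lookup z (v, j) = (if j = w then Poly_Mapping.lookup z (v, w) else 0)" for j
          using z(2) w by (auto simp: T_def in_keys_iff)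
        then have "(\<Sum>j \<in> {v<..n + 1}. Poly_Mapping.lookup z (v, j))
            = (\<Sum>j \<in> {v<..n + 1}. if j = w then Poly_Mapping.lookup z (v, w) else 0)"
          by (intro sum.cong) auto
        also have "\<dots> = Poly_Mapping.lookup z (v, w)" using vw by (auto simp: K_edges_def)
        finally have "net_outflow n z v = Poly_Mapping.lookup z (v, w)"
          by (simp add: net_outflow_def less.IH)
        with z(1) v \<open>Poly_Mapping.lookup z (v, w) \<noteq> 0\<close> show False by (simp add: circulations_def)
      qed
    qed
    then show ?thesis by (intro poly_mapping_eqI) (auto simp: split_paired_all)
  qed
  obtain c where c: "\<And>e. e \<in> H - T \<Longrightarrow> c e \<in> circulations n H"
    "\<And>e e'. e \<in> H - T \<Longrightarrow> e' \<in> H - T \<Longrightarrow> Poly_Mapping.lookup (c e) e' = (if e' = e then 1 else 0)"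
    using cycle by metis
  have fin: "finite (H - T)" using D(2) by simp
  have inj: "inj_on c (H - T)"
    by (rule inj_onI) (metis c(2) zero_neq_one)
  \<comment> \<open>Coefficients can be read off at the edges outside the tree; both independence
    and spanning rest on this.\<close>
  have coord: "Poly_Mapping.lookup (\<Sum>e\<in>H - T. r e *\<^sub>R c e) e' = r e'" if "e' \<in> H - T" for r e'
  proof -
    have "Poly_Mapping.lookup (\<Sum>e\<in>H - T. r e *\<^sub>R c e) e'
        = (\<Sum>e\<in>H - T. if e' = e then r e else 0)"
      unfolding lookup_sum lookup_scaleR using c(2) that by (intro sum.cong) auto
    then show ?thesis using fin that by simp
  qed
  have "independent (c ` (H - T))"
  proof (rule real_vector.independent_if_scalars_zero)
    show "finite (c ` (H - T))" using fin by simp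
    fix f x assume "(\<Sum>x\<in>c ` (H - T). f x *\<^sub>R x) = 0" and x: "x \<in> c ` (H - T)"
    then have "(\<Sum>e\<in>H - T. f (c e) *\<^sub>R c e) = 0" by (simp add: sum.reindex[OF inj])
    then show "f x = 0" using coord[of _ "\<lambda>e. f (c e)"] x by fastforce
  qed
  moreover have "circulations n H \<subseteq> span (c ` (H - T))"
  proof
    fix z assume z: "z \<in> circulations n H"
    \<comment> \<open>\<open>?y\<close> agrees with \<open>z\<close> outside the tree, so
      \<open>z - ?y\<close> is a circulation on the tree and vanishes.\<close>
    let ?y = "\<Sum>e\<in>H - T. Poly_Mapping.lookup z e *\<^sub>R c e"
    have y: "?y \<in> span (c ` (H - T))" by (intro span_sum span_mul span_base) auto
    have "net_outflow n ?y i = 0" if "i \<in> {1..n}" for i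
      unfolding net_outflow_sum using c(1) that
      by (intro sum.neutral) (auto simp: circulations_def net_outflow_scaleR)
    moreover have "Poly_Mapping.keys ?y \<subseteq> H"
    proof -
      have "Poly_Mapping.lookup (c e') e = 0" if "e \<notin> H" "e' \<in> H - T" for e e'
      proof -
        have "Poly_Mapping.keys (c e') \<subseteq> H" using c(1)[OF that(2)] by (simp add: circulations_def)
        with that(1) show ?thesis by (metis in_keys_iff subsetD)
      qed
      then have "Poly_Mapping.lookup ?y e = 0" if "e \<notin> H" for e
        unfolding lookup_sum lookup_scaleR using that by (intro sum.neutral) simp
      then show ?thesis by (auto simp: in_keys_iff)
    qed
    ultimately have circ: "z - ?y \<in> circulations n H"
      using z keys_diff[of z ?y] by (auto simp: circulations_def net_outflow_diff)
    moreover have "Poly_Mapping.keys (z - ?y) \<subseteq> T"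
    proof -
      have "Poly_Mapping.lookup (z - ?y) e = 0" if "e \<in> H - T" for e
        using coord[OF that] by (simp add: lookup_minus)
      then show ?thesis using circ by (force simp: circulations_def in_keys_iff)
    qed
    ultimately have "z - ?y = 0" by (rule tree_zero)
    with y show "z \<in> span (c ` (H - T))" by simp
  qed
  ultimately have "dim (circulations n H) = card (H - T)"
    using c(1) card_image[OF inj] by (intro dim_unique) auto
  \<comment> \<open>The tree has one edge per tail, and the heads are the tails together with the
    sink; this is the source of the \<open>+ 1\<close>.\<close>
  also have "int (card (H - T)) = int (card H) - int (card (fst ` H))"
    using TH D(2) card_mono[OF D(2) TH] unfolding cardT[symmetric]
    by (simp add: card_Diff_subset finite_subset of_nat_diff)
  finally show ?thesis using D(7) by simp
qed

lemma affine_dim_supported_flows: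
  assumes H: "H \<in> support_graphs n" and n: "n \<ge> 1"
  shows "affine_dim (supported_flows n H) = int (card H) - int (card (heads H)) + 1"
proof -
  have "supported_flows n H \<noteq> {}"
    using exists_flow_with_support[OF H n] by (auto simp: supported_flows_def)
  then show ?thesis
    unfolding affine_dim_def dim_circulations[OF H, symmetric]
    using span_eq_dim[OF span_differences_supported_flows[OF H n]] by simp
qed

section \<open>From faces to the f-polynomial\<close>

lemma f_polynomial_eq_sum_faces:
  assumes fin: "finite {F. F face_of P}"
    and le: "\<And>F. F face_of P \<Longrightarrow> affine_dim F \<le> affine_dim P"
  shows "f_polynomial P = (\<Sum>F | F face_of P. fls_X_intpow (affine_dim F))"
proof -
  have "affine_dim F \<ge> -1" for F :: "'a set" by (simp add: affine_dim_def)
  \<comment> \<open>Grouping the faces by dimension loses none, because all dimensions lie in the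
    range of summation.\<close>
  with le have "affine_dim ` {F. F face_of P} \<subseteq> {-1..affine_dim P}" by auto
  then have "(\<Sum>F | F face_of P. fls_X_intpow (affine_dim F) :: int fls)
      = (\<Sum>d \<in> {-1..affine_dim P}. \<Sum>F | F \<in> {F. F face_of P} \<and> affine_dim F = d. fls_X_intpow (affine_dim F))"
    using fin by (intro sum.group[symmetric]) auto
  also have "\<dots> = f_polynomial P"
    unfolding f_polynomial_def f_number_def
    by (intro sum.cong refl) (simp cong: conj_cong)
  finally show ?thesis by simp
qed

text \<open>Every additional tail needs an additional edge, and heads outnumber tails by exactly
  one. This bounds the dimension of each face by that of the polytope.\<close>

lemma support_graph_corank_mono:
  assumes H: "H \<in> support_graphs n" and K: "K \<in> support_graphs n" and sub: "H \<subseteq> K"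
  shows "int (card H) - int (card (heads H)) \<le> int (card K) - int (card (heads K))"
proof -
  note D = support_graphsD[OF H] and E = support_graphsD[OF K]
  have "fst ` K \<subseteq> fst ` H \<union> fst ` (K - H)" by blast
  then have "card (fst ` K) \<le> card (fst ` H \<union> fst ` (K - H))" using D(2) E(2) by (intro card_mono) auto
  also have "\<dots> \<le> card (fst ` H) + card (fst ` (K - H))" by (rule card_Un_le)
  also have "card (fst ` (K - H)) \<le> card (K - H)" using E(2) by (intro card_image_le) auto
  also have "card (K - H) = card K - card H" using sub D(2) by (simp add: card_Diff_subset)
  finally show ?thesis using D(7) E(7) card_mono[OF E(2) sub] by simp
qed

lemma f_polynomial_CRY:
  assumes n: "n \<ge> 1"
  shows "f_polynomial (CRY n) = fls_X_intpow (-1)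
    + (\<Sum>H \<in> support_graphs n. fls_X_intpow (int (card H) - int (card (heads H)) + 1))"
proof -
  \<comment> \<open>The complete graph yields the whole polytope as its face, the one of largest
    dimension.\<close>
  have K: "K_edges n \<in> support_graphs n"
  proof -
    have "fst ` K_edges n = {1..n}"
    proof
      show "{1..n} \<subseteq> fst ` K_edges n"
        by (rule subsetI, rule image_eqI[where x = "(_, n + 1)"]) (auto simp: K_edges_def)
    qed (auto simp: K_edges_def)
    moreover have "snd ` K_edges n = {2..n + 1}"
    proof
      show "{2..n + 1} \<subseteq> snd ` K_edges n"
        by (rule subsetI, rule image_eqI[where x = "(1, _)"]) (auto simp: K_edges_def)
    qed (auto simp: K_edges_def)
    ultimately show ?thesis using n by (auto simp: support_graphs_def heads_def)
  qed
  have whole: "supported_flows n (K_edges n) = CRY n"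
    by (auto simp: supported_flows_def CRY_iff)
  note faces = faces_of_CRY[OF n]
  have ne: "{} \<notin> supported_flows n ` support_graphs n"
    using exists_flow_with_support[OF _ n] by (auto simp: supported_flows_def)
  have "affine_dim F \<le> affine_dim (CRY n)" if "F face_of CRY n" for F
  proof -
    from that have "F \<in> insert {} (supported_flows n ` support_graphs n)" unfolding faces[symmetric] by simp
    then consider "F = {}" | H where "H \<in> support_graphs n" "F = supported_flows n H" by blast
    then show ?thesis
    proof cases
      case 1
      then show ?thesis by (simp add: affine_dim_def)
    next
      case 2
      then show ?thesis
        unfolding whole[symmetric]
        using support_graph_corank_mono[OF 2(1) K] support_graphsD(1)[OF 2(1)]
        by (simp add: affine_dim_supported_flows[OF _ n] K)
    qed
  qed
  then have "f_polynomial (CRY n) = (\<Sum>F | F face_of CRY n. fls_X_intpow (affine_dim F))"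
    by (intro f_polynomial_eq_sum_faces) (simp_all add: faces finite_support_graphs)
  also have "\<dots> = fls_X_intpow (affine_dim ({} :: ((nat \<times> nat) \<Rightarrow>\<^sub>0 real) set))
      + (\<Sum>H \<in> support_graphs n. fls_X_intpow (affine_dim (supported_flows n H)))"
    unfolding faces using ne
    by (simp add: finite_support_graphs sum.reindex[OF inj_on_supported_flows[OF n]])
  finally show ?thesis
    by (simp add: affine_dim_supported_flows[OF _ n] affine_dim_def[of "{}"])
qed

theorem theorem4p4:
  fixes n :: nat
  assumes "n \<ge> 2"
  shows "fls_X * f_polynomial (CRY n) = (1 + fls_X) ^ n * primitive_f_polynomial (n - 1)"
proof -
  obtain m where m: "n = m + 2" using assms by (metis add.commute le_Suc_ex)
  let ?X = "fls_X :: int fls"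
  have pow: "?X ^ k = fls_X_intpow (int k)" for k by (simp add: fls_X_power_conv_shift_1)
  note intpow_add = fls_X_intpow_times_fls_X_intpow[where ?'a = int]
  \<comment> \<open>Multiplying by \<open>?X ^ (m + 1)\<close> turns the Laurent monomials into
    ordinary powers, as needed for \<open>support_graphs_relation\<close>; the empty face becomes
    the additive term \<open>?X ^ (m + 1)\<close>.\<close>
  have "?X ^ (m + 1) * (?X * f_polynomial (CRY n))
      = (\<Sum>H \<in> support_graphs n. ?X ^ (card (K_verts n - heads H) + card H)) + ?X ^ (m + 1)"
  proof -
    have "?X ^ (m + 2) * fls_X_intpow (int (card H) - int (card (heads H)) + 1)
        = ?X ^ (card (K_verts n - heads H) + card H)" if "H \<in> support_graphs n" for H
    proof -
      have "heads H \<subseteq> K_verts n" using rooted_graphsD(5) support_graphsD(4)[OF that] by (auto simp: K_verts_def)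
      then have "int (card (K_verts n - heads H)) = int (n + 1) - int (card (heads H))"
        by (subst card_Diff_subset)
          (auto simp: K_verts_def support_graphsD(6)[OF that] of_nat_diff card_mono[of "{1..n + 1}", simplified])
      then have "int (m + 2) + (int (card H) - int (card (heads H)) + 1)
          = int (card (K_verts n - heads H) + card H)" by (simp add: m)
      then show ?thesis unfolding pow intpow_add by (simp only:)
    qed
    moreover have "?X ^ (m + 2) * fls_X_intpow (-1) = ?X ^ (m + 1)"
      unfolding pow intpow_add by simp
    ultimately have "?X ^ (m + 2) * f_polynomial (CRY n)
        = ?X ^ (m + 1) + (\<Sum>H \<in> support_graphs n. ?X ^ (card (K_verts n - heads H) + card H))"
      using assms by (simp add: f_polynomial_CRY distrib_left sum_distrib_left)
    then show ?thesis by (simp add: ac_simps)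
  qed
  also have "\<dots> = (1 + ?X) ^ n
      * (\<Sum>H | H \<in> support_graphs (m + 1) \<and> heads H = K_verts (m + 1). ?X ^ card H)"
    unfolding m by (rule support_graphs_relation)
  also have "(\<Sum>H | H \<in> support_graphs (m + 1) \<and> heads H = K_verts (m + 1). ?X ^ card H)
      = ?X ^ (m + 1) * primitive_f_polynomial (n - 1)"
  proof -
    have "primitive_f_polynomial (m + 1)
        = (\<Sum>H | H \<in> support_graphs (m + 1) \<and> heads H = K_verts (m + 1). fls_X_intpow (betti1 H))"
      unfolding primitive_f_polynomial_def
      by (intro sum.cong) (auto simp: valid_subgraph_iff_support_graph primitive_subgraph_iff)
    \<comment> \<open>A graph reaching all \<open>m + 2\<close> vertices has first Betti number
      \<open>card H - (m + 1)\<close>.\<close>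
    moreover have "?X ^ (m + 1) * fls_X_intpow (betti1 H) = ?X ^ card H"
      if "H \<in> support_graphs (m + 1)" "heads H = K_verts (m + 1)" for H
      unfolding pow intpow_add betti1_support_graph[OF that(1), simplified] that(2) by (simp add: K_verts_def)
    ultimately show ?thesis by (simp add: m sum_distrib_left)
  qed
  finally have "?X ^ (m + 1) * (?X * f_polynomial (CRY n))
      = ?X ^ (m + 1) * ((1 + ?X) ^ n * primitive_f_polynomial (n - 1))"
    by (simp add: ac_simps)
  \<comment> \<open>The common factor is a nonzero element of an integral domain and
    cancels.\<close>
  then show ?thesis by (subst (asm) mult_cancel_left) simp
qed

end
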